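(* Let $X\subseteq\mathbb{R}^m$ and $Y\subseteq\mathbb{R}^n$ be nonempty, compact and convex, and let $\mathcal{Q}(x)=\inf\{f(y,x):y\in Y\}$ for $x\in X$. Assume that $f$ is differentiable and convex on $Y\times X$. Let $\bar x\in X$, $\varepsilon\ge0$, and let $\hat y(\varepsilon)\in Y$ be an $\varepsilon$-optimal solution of the problem $\inf\{f(y,\bar x):y\in Y\}$, i.e. $\mathcal{Q}(\bar x)\ge f(\hat y(\varepsilon),\bar x)-\varepsilon$. Set $$\eta(\varepsilon)=\ell_1(\hat y(\varepsilon),\bar x):=\max_{y\in Y}\langle\nabla_yf(\hat y(\varepsilon),\bar x),\hat y(\varepsilon)-y\rangle .$$ Then the affine function $$\mathcal{C}(x):=f(\hat y(\varepsilon),\bar x)-\eta(\varepsilon)+\langle\nabla_xf(\hat y(\varepsilon),\bar x),x-\bar x\rangle$$ is a cut for $\mathcal{Q}$ at $\bar x$, i.e. $\mathcal{Q}(x)\ge\mathcal{C}(x)$ for every $x\in X$, and $\eta(\varepsilon)$ is an upper bound for the distance $\mathcal{Q}(\bar x)-\mathcal{C}(\bar x)$.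
   Context: A cut for $\mathcal{Q}$ is an affine function $\mathcal{C}$ with $\mathcal{Q}(x)\ge\mathcal{C}(x)$ for all $x\in X$. $\nabla_y f,\nabla_x f$ denote partial gradients with respect to the first and second argument of $f(y,x)$. *)

theory Defs
  imports "HOL-Analysis.Analysis"
begin

definition value_function ::
    "((real ^ 'n) \<times> (real ^ 'm) \<Rightarrow> real) \<Rightarrow> (real ^ 'n) set \<Rightarrow> real ^ 'm \<Rightarrow> real"
  where "value_function f Y x = (INF y\<in>Y. f (y, x))"

text \<open>
  \<open>gy\<close> and \<open>gx\<close> below are the fields of partial gradients of \<open>f\<close> on \<open>Y \<times> X\<close>.  The derivatives are
  taken within \<open>Y\<close> and \<open>X\<close>, so \<open>f\<close> may also be differentiable on \<open>Y \<times> X\<close> only in the relative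
  sense of \<open>differentiable_on\<close>.  If \<open>f\<close> is differentiable in a neighbourhood, its ordinary partial
  gradients satisfy these predicates.  When \<open>Y\<close> or \<open>X\<close> has empty interior, further vector fields may
  satisfy them too, which is why they are relations between \<open>f\<close> and a field and not functions of \<open>f\<close>.
\<close>

definition is_partial_gradient_y ::
    "((real ^ 'n) \<times> (real ^ 'm) \<Rightarrow> real) \<Rightarrow> (real ^ 'n) set \<Rightarrow> (real ^ 'm) set \<Rightarrow>
     ((real ^ 'n) \<times> (real ^ 'm) \<Rightarrow> real ^ 'n) \<Rightarrow> bool"
  where "is_partial_gradient_y f Y X gy \<longleftrightarrow>
    (\<forall>y\<in>Y. \<forall>x\<in>X. ((\<lambda>y'. f (y', x)) has_derivative (\<lambda>h. gy (y, x) \<bullet> h)) (at y within Y))"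

definition is_partial_gradient_x ::
    "((real ^ 'n) \<times> (real ^ 'm) \<Rightarrow> real) \<Rightarrow> (real ^ 'n) set \<Rightarrow> (real ^ 'm) set \<Rightarrow>
     ((real ^ 'n) \<times> (real ^ 'm) \<Rightarrow> real ^ 'm) \<Rightarrow> bool"
  where "is_partial_gradient_x f Y X gx \<longleftrightarrow>
    (\<forall>y\<in>Y. \<forall>x\<in>X. ((\<lambda>x'. f (y, x')) has_derivative (\<lambda>k. gx (y, x) \<bullet> k)) (at x within X))"

definition eps_optimal_solution ::
    "((real ^ 'n) \<times> (real ^ 'm) \<Rightarrow> real) \<Rightarrow> (real ^ 'n) set \<Rightarrow> real ^ 'm \<Rightarrow> real \<Rightarrow> real ^ 'n \<Rightarrow> bool"
  where "eps_optimal_solution f Y x \<epsilon> y \<longleftrightarrow>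
    y \<in> Y \<and> value_function f Y x \<ge> f (y, x) - \<epsilon>"

text \<open>
  \<open>GREATEST\<close> is a genuine maximum: it is attained here because \<open>Y\<close> is nonempty and compact.
\<close>

definition ell1 ::
    "((real ^ 'n) \<times> (real ^ 'm) \<Rightarrow> real ^ 'n) \<Rightarrow> (real ^ 'n) set \<Rightarrow> real ^ 'n \<Rightarrow> real ^ 'm \<Rightarrow> real"
  where "ell1 gy Y yh x = (GREATEST t. t \<in> (\<lambda>y. gy (yh, x) \<bullet> (yh - y)) ` Y)"

definition affine_function :: "(real ^ 'm \<Rightarrow> real) \<Rightarrow> bool"
  where "affine_function C \<longleftrightarrow> (\<exists>a b. \<forall>x. C x = a \<bullet> x + b)"

definition is_cut :: "(real ^ 'm \<Rightarrow> real) \<Rightarrow> (real ^ 'm) set \<Rightarrow> (real ^ 'm \<Rightarrow> real) \<Rightarrow> bool"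
  where "is_cut Q X C \<longleftrightarrow> affine_function C \<and> (\<forall>x\<in>X. Q x \<ge> C x)"

end

theory Submission
  imports Defs
begin

text \<open>
  A differentiable convex function lies above its linearization, so with \<open>D\<close> the derivative of \<open>f\<close>
  at \<open>(yhat, xbar)\<close>,
  \<open>f (y, x) \<ge> f (yhat, xbar) + D (y - yhat, 0) + D (0, x - xbar)\<close>
  for all \<open>y \<in> Y\<close> and \<open>x \<in> X\<close>.  The two increments are the partial ones, given by the
  partial gradients.  The first is bounded below by \<open>-\<eta>\<close>, as \<open>\<eta>\<close> is the maximal decrease that the
  linearization in \<open>y\<close> can promise over \<open>Y\<close>.  The bound that remains is \<open>C x\<close>, which does not depend
  on \<open>y\<close>; taking the infimum over \<open>y\<close> gives the cut.  For the gap, \<open>C xbar = f (yhat, xbar) - \<eta>\<close>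
  while the value function at \<open>xbar\<close> is at most \<open>f (yhat, xbar)\<close>.

  The sets may have empty interior, and a derivative within such a set is not unique as a linear map.
  It is unique along directions that point to another point of a convex set, because there it is the
  limit of one-sided difference quotients (\<open>difference_quotient_tendsto\<close>).  Both the tangent
  inequality (\<open>convex_on_above_tangent_within\<close>) and the identification of the partial increments
  (\<open>has_derivative_within_convex_unique\<close>) rest on that limit, and only such directions occur above.
\<close>

lemma difference_quotient_tendsto:
  fixes g :: "'a::real_normed_vector \<Rightarrow> real"
  assumes "(g has_derivative D) (at a within S)" "convex S" "a \<in> S" "b \<in> S"
  shows "((\<lambda>t. (g (a + t *\<^sub>R (b - a)) - g a) / t) \<longlongrightarrow> D (b - a)) (at_right 0)"
proof -
  let ?p = "\<lambda>t::real. a + t *\<^sub>R (b - a)"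
  have sub: "?p ` {0..1} \<subseteq> S"
  proof clarify
    fix t :: real
    assume "t \<in> {0..1}"
    then have "(1 - t) *\<^sub>R a + t *\<^sub>R b \<in> S"
      using assms(2-4) by (intro convexD) auto
    then show "?p t \<in> S" by (simp add: algebra_simps)
  qed
  have p: "(?p has_derivative (\<lambda>t. t *\<^sub>R (b - a))) (at 0 within {0..1})"
    by (auto intro!: derivative_eq_intros)
  have "((\<lambda>t. g (?p t)) has_derivative (\<lambda>t. D (t *\<^sub>R (b - a)))) (at 0 within {0..1})"
    using has_derivative_in_compose[OF p, of g D]
      has_derivative_subset[OF _ sub, of g D a] assms(1) by simp
  then have "((\<lambda>t. g (?p t)) has_real_derivative D (b - a)) (at 0 within {0..1})"
    by (simp add: has_field_derivative_def linear_scale mult_commute_abs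
        has_derivative_linear[OF assms(1)])
  then show ?thesis
    by (simp add: has_field_derivative_iff at_within_Icc_at_right)
qed

lemma has_derivative_within_convex_unique:
  fixes g :: "'a::real_normed_vector \<Rightarrow> real"
  assumes "(g has_derivative D) (at a within S)" "(g has_derivative D') (at a within S)"
    and "convex S" "a \<in> S" "b \<in> S"
  shows "D (b - a) = D' (b - a)"
  using tendsto_unique[OF trivial_limit_at_right_real
      difference_quotient_tendsto[OF assms(1,3-5)] difference_quotient_tendsto[OF assms(2-5)]] .

text \<open>
  By convexity every difference quotient on the segment from \<open>a\<close> to \<open>b\<close> is at most the one for the
  whole segment, \<open>g b - g a\<close>; the derivative is the limit of these quotients.
\<close>

lemma convex_on_above_tangent_within:
  fixes g :: "'a::real_normed_vector \<Rightarrow> real"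
  assumes "convex_on S g" "(g has_derivative D) (at a within S)" "a \<in> S" "b \<in> S"
  shows "g a + D (b - a) \<le> g b"
proof -
  have "(g (a + t *\<^sub>R (b - a)) - g a) / t \<le> g b - g a" if "0 < t" "t < 1" for t
  proof -
    have "g ((1 - t) *\<^sub>R a + t *\<^sub>R b) \<le> (1 - t) * g a + t * g b"
      using convex_onD[OF assms(1)] that assms by simp
    moreover have "(1 - t) *\<^sub>R a + t *\<^sub>R b = a + t *\<^sub>R (b - a)"
      by (simp add: algebra_simps)
    ultimately show ?thesis
      using that by (simp add: field_simps)
  qed
  then have "\<forall>\<^sub>F t in at_right 0. (g (a + t *\<^sub>R (b - a)) - g a) / t \<le> g b - g a"
    by (auto simp: eventually_at_right_field intro!: exI[of _ 1])
  with difference_quotient_tendsto[OF assms(2) convex_on_imp_convex[OF assms(1)] assms(3,4)]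
  have "D (b - a) \<le> g b - g a"
    by (intro tendsto_upperbound) auto
  then show ?thesis by simp
qed

text \<open>
  \<open>Dy\<close> and \<open>Dx\<close> need not be the restrictions of the joint derivative to the two factors, but they
  agree with them on \<open>y - v\<close> and \<open>x - u\<close>.  Joint differentiability is essential: it is what makes
  the slope in the direction \<open>(y - v, x - u)\<close> split into the two partial slopes.
\<close>

lemma convex_on_above_partial_tangents:
  fixes f :: "'a::real_normed_vector \<times> 'b::real_normed_vector \<Rightarrow> real"
  assumes cvx: "convex_on (Y \<times> X) f" "convex Y" "convex X"
    and diff: "f differentiable (at (v, u) within Y \<times> X)"
    and Dy: "((\<lambda>y'. f (y', u)) has_derivative Dy) (at v within Y)"
    and Dx: "((\<lambda>x'. f (v, x')) has_derivative Dx) (at u within X)"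
    and mem: "v \<in> Y" "u \<in> X" "y \<in> Y" "x \<in> X"
  shows "f (v, u) + Dy (y - v) + Dx (x - u) \<le> f (y, x)"
proof -
  obtain D where D: "(f has_derivative D) (at (v, u) within Y \<times> X)"
    using diff by (auto simp: differentiable_def)
  have "((\<lambda>y'. f (y', u)) has_derivative (\<lambda>h. D (h, 0))) (at v within Y)"
  proof (rule has_derivative_in_compose[where f = "\<lambda>y'. (y', u)"])
    show "((\<lambda>y'. (y', u)) has_derivative (\<lambda>h. (h, 0))) (at v within Y)"
      by (auto intro!: derivative_eq_intros)
    show "(f has_derivative D) (at (v, u) within (\<lambda>y'. (y', u)) ` Y)"
      by (rule has_derivative_subset[OF D]) (use mem in auto)
  qed
  with Dy have y: "Dy (y - v) = D (y - v, 0)"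
    using has_derivative_within_convex_unique cvx(2) mem by blast
  have "((\<lambda>x'. f (v, x')) has_derivative (\<lambda>k. D (0, k))) (at u within X)"
  proof (rule has_derivative_in_compose[where f = "\<lambda>x'. (v, x')"])
    show "((\<lambda>x'. (v, x')) has_derivative (\<lambda>k. (0, k))) (at u within X)"
      by (auto intro!: derivative_eq_intros)
    show "(f has_derivative D) (at (v, u) within (\<lambda>x'. (v, x')) ` X)"
      by (rule has_derivative_subset[OF D]) (use mem in auto)
  qed
  with Dx have x: "Dx (x - u) = D (0, x - u)"
    using has_derivative_within_convex_unique cvx(3) mem by blast
  have "D ((y, x) - (v, u)) = D (y - v, 0) + D (0, x - u)"
    by (simp flip: linear_add[OF has_derivative_linear[OF D]])
  moreover have "f (v, u) + D ((y, x) - (v, u)) \<le> f (y, x)"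
    using mem by (intro convex_on_above_tangent_within[OF cvx(1) D]) auto
  ultimately show ?thesis
    using x y by simp
qed

text \<open>
  Compactness of \<open>Y\<close> makes the maximum in \<open>ell1\<close> attained; without an attained maximum \<open>GREATEST\<close>
  would be an unspecified number.
\<close>

lemma ell1_upper_bound:
  assumes "compact Y" "y \<in> Y"
  shows "gy (v, u) \<bullet> (v - y) \<le> ell1 gy Y v u"
proof -
  have "continuous_on Y (\<lambda>y. gy (v, u) \<bullet> (v - y))"
    by (intro continuous_intros)
  then obtain z where "z \<in> Y" "\<forall>y\<in>Y. gy (v, u) \<bullet> (v - y) \<le> gy (v, u) \<bullet> (v - z)"
    using continuous_attains_sup[OF assms(1)] assms(2) by blast
  then have "ell1 gy Y v u = gy (v, u) \<bullet> (v - z)"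
    unfolding ell1_def by (intro Greatest_equality) auto
  then show ?thesis
    using \<open>\<forall>y\<in>Y. _ y\<close> assms(2) by simp
qed

theorem proposition2p2:
  fixes X :: "(real ^ 'm) set" and Y :: "(real ^ 'n) set"
    and f :: "(real ^ 'n) \<times> (real ^ 'm) \<Rightarrow> real"
    and grad_y :: "(real ^ 'n) \<times> (real ^ 'm) \<Rightarrow> real ^ 'n"
    and grad_x :: "(real ^ 'n) \<times> (real ^ 'm) \<Rightarrow> real ^ 'm"
    and xbar :: "real ^ 'm" and yhat :: "real ^ 'n" and \<epsilon> :: real
    and \<eta> :: real and C :: "real ^ 'm \<Rightarrow> real"
  assumes "X \<noteq> {}" "compact X" "convex X"
    and "Y \<noteq> {}" "compact Y" "convex Y"
    and "f differentiable_on (Y \<times> X)"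
    and "convex_on (Y \<times> X) f"
    and "is_partial_gradient_y f Y X grad_y"
    and "is_partial_gradient_x f Y X grad_x"
    and "xbar \<in> X" "\<epsilon> \<ge> 0"
    and "eps_optimal_solution f Y xbar \<epsilon> yhat"
    and "\<eta> = ell1 grad_y Y yhat xbar"
    and "C = (\<lambda>x. f (yhat, xbar) - \<eta> + grad_x (yhat, xbar) \<bullet> (x - xbar))"
  shows "is_cut (value_function f Y) X C
    \<and> value_function f Y xbar - C xbar \<le> \<eta>"
proof -
  have yhat: "yhat \<in> Y"
    using assms(13) by (simp add: eps_optimal_solution_def)
  have lower: "C x \<le> f (y, x)" if "y \<in> Y" "x \<in> X" for y x
  proof -
    have "f (yhat, xbar) + grad_y (yhat, xbar) \<bullet> (y - yhat) + grad_x (yhat, xbar) \<bullet> (x - xbar)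
        \<le> f (y, x)"
    proof (rule convex_on_above_partial_tangents[of Y X])
      show "f differentiable (at (yhat, xbar) within Y \<times> X)"
        using assms(7,11) yhat by (auto simp: differentiable_on_def)
    qed (use assms that yhat in \<open>auto simp: is_partial_gradient_y_def is_partial_gradient_x_def\<close>)
    moreover have "grad_y (yhat, xbar) \<bullet> (yhat - y) \<le> \<eta>"
      using ell1_upper_bound[OF assms(5) that(1)] assms(14) by simp
    ultimately show ?thesis
      by (simp add: assms(15) inner_diff_right)
  qed
  have cut: "C x \<le> value_function f Y x" if "x \<in> X" for x
    unfolding value_function_def using lower that assms(4) by (intro cINF_greatest) auto
  have "C x = grad_x (yhat, xbar) \<bullet> x
      + (f (yhat, xbar) - \<eta> - grad_x (yhat, xbar) \<bullet> xbar)" for x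
    by (simp add: assms(15) inner_diff_right)
  then have "affine_function C"
    unfolding affine_function_def by blast
  moreover have "value_function f Y xbar \<le> f (yhat, xbar)"
    unfolding value_function_def
  proof (rule cINF_lower)
    \<comment> \<open>\<open>C xbar\<close> bounds the values below, which makes the infimum over \<open>Y\<close> a genuine one.\<close>
    show "bdd_below ((\<lambda>y. f (y, xbar)) ` Y)"
      using lower assms(11) by (intro bdd_belowI2)
  qed (rule yhat)
  ultimately show ?thesis
    using cut by (simp add: is_cut_def assms(15))
qed

end
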